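(* Let $n\ge 0$. (1) Each $n$-soliton $\psi_n$ can be written as a linear combination, with coefficients constant in $x$ (and independent of $\lambda$), of the basic functions $\phi_n,\phi_{n-1},\ldots,\phi_0$. (2) Let $\alpha_0,\ldots,\alpha_n$ be constants with $\alpha_n\neq 0$. The linear combination $\psi_n=\alpha_n\phi_n+\alpha_{n-1}\phi_{n-1}+\cdots+\alpha_0\phi_0$ is an $n$-soliton if and only if $\alpha_nF_n+\alpha_{n-1}F_{n-1}+\cdots+\alpha_0F_0$ is constant (as a function of $x$).
   Context: Let $q$ be a smooth complex-valued function of $x$ on an open interval; $'$ denotes $d/dx$, and $\lambda$ is a parameter independent of $x$. Let $B$ be the linear operator $B(f)=f'''+4qf'+2q'f$. The functions $F_n$ ($n\ge -1$) are defined recursively by $F_{-1}=\tfrac12$ and $F_{n+1}=\int B(F_n)\,dx$, i.e. $F_{n+1}'=B(F_n)$, with all constants of integration equal to zero: for $n\ge0$, $F_n$ is a differential polynomial in $q$ (a polynomial in $q,q',q'',\dots$) with zero constant term. Thus $F_0=q$, $F_1=q''+3q^2$, etc. Set $\phi_n=\sum_{j=0}^{n}(4\lambda)^{n-j}F_{j-1}$. An $n$-soliton is a function of the form $\psi_n=A_{-1}(4\lambda)^n+A_0(4\lambda)^{n-1}+\cdots+A_{n-2}(4\lambda)+A_{n-1}$, with $A_{-1}$ a nonzero constant and $A_i=A_i(x)$ smooth functions of $x$ (not depending on $\lambda$) for $0\le i\le n-1$, satisfying $B(\psi_n)=4\lambda\psi_n'$ identically in $x$ and as polynomials in $\lambda$.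 *)

theory Defs
  imports "HOL-Analysis.Analysis" "HOL-Library.Poly_Mapping"
begin

text \<open>
  Differential polynomials in one unknown \<open>q\<close>: polynomials over the complex numbers in
  variables indexed by \<open>k :: nat\<close>, the variable with index \<open>k\<close> standing for the
  \<open>k\<close>-th derivative of \<open>q\<close>. A monomial is its finitely supported exponent function.
\<close>

type_synonym diffpoly = "(nat \<Rightarrow>\<^sub>0 nat) \<Rightarrow>\<^sub>0 complex"

definition dp_const :: "complex \<Rightarrow> diffpoly" where
  "dp_const c = Poly_Mapping.single 0 c"

definition dp_var :: "nat \<Rightarrow> diffpoly" where
  "dp_var k = Poly_Mapping.single (Poly_Mapping.single k 1) 1"

text \<open>
  The derivation which sends variable \<open>k\<close> to variable \<open>k + 1\<close> and kills constants. By the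
  Leibniz rule it replaces, in each monomial and for each variable \<open>k\<close> occurring in it with
  exponent \<open>e\<close>, one factor \<open>k\<close> by a factor \<open>k + 1\<close>, with weight \<open>e\<close>.
\<close>

definition dp_deriv :: "diffpoly \<Rightarrow> diffpoly" where
  "dp_deriv P =
     (\<Sum>m\<in>Poly_Mapping.keys P. \<Sum>k\<in>Poly_Mapping.keys m.
        Poly_Mapping.single
          (m - Poly_Mapping.single k 1 + Poly_Mapping.single (Suc k) 1)
          (of_nat (Poly_Mapping.lookup m k) * Poly_Mapping.lookup P m))"

definition dp_B :: "diffpoly \<Rightarrow> diffpoly" where
  "dp_B P = (dp_deriv ^^ 3) P + 4 * dp_var 0 * dp_deriv P + 2 * dp_var 1 * P"

text \<open>
  Indices are shifted by one: \<open>dp_F j\<close> is $F_{j-1}$, so \<open>dp_F 0\<close> is $F_{-1} = 1/2$.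
  The recursion $F_{n+1}' = B(F_n)$ is an identity of differential polynomials. Its solution is
  unique once the constant term is required to vanish (all constants of integration are zero),
  since only constants have derivative zero.
\<close>

primrec dp_F :: "nat \<Rightarrow> diffpoly" where
  "dp_F 0 = dp_const (1/2)"
| "dp_F (Suc j) = (THE P. dp_deriv P = dp_B (dp_F j) \<and> Poly_Mapping.lookup P 0 = 0)"

abbreviation ddx :: "(real \<Rightarrow> complex) \<Rightarrow> real \<Rightarrow> complex" where
  "ddx f \<equiv> (\<lambda>x. vector_derivative f (at x))"

text \<open>Intended for open \<open>I\<close> only, where two-sided derivatives at points of \<open>I\<close> see only
  the values of \<open>f\<close> on \<open>I\<close>.\<close>

definition smooth_on_open :: "real set \<Rightarrow> (real \<Rightarrow> complex) \<Rightarrow> bool" where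
  "smooth_on_open I f \<longleftrightarrow> (\<forall>k. \<forall>x\<in>I. (ddx ^^ k) f differentiable (at x))"

definition dp_eval :: "diffpoly \<Rightarrow> (real \<Rightarrow> complex) \<Rightarrow> real \<Rightarrow> complex" where
  "dp_eval P q x =
     (\<Sum>m\<in>Poly_Mapping.keys P. Poly_Mapping.lookup P m *
        (\<Prod>k\<in>Poly_Mapping.keys m. ((ddx ^^ k) q x) ^ Poly_Mapping.lookup m k))"

text \<open>\<open>kdv_F q j\<close> is the function $F_{j-1}$ of \<open>x\<close>, with the index shift of \<open>dp_F\<close>.\<close>

definition kdv_F :: "(real \<Rightarrow> complex) \<Rightarrow> nat \<Rightarrow> real \<Rightarrow> complex" where
  "kdv_F q j = dp_eval (dp_F j) q"

definition kdv_B :: "(real \<Rightarrow> complex) \<Rightarrow> (real \<Rightarrow> complex) \<Rightarrow> real \<Rightarrow> complex" where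
  "kdv_B q f = (\<lambda>x. (ddx ^^ 3) f x + 4 * q x * ddx f x + 2 * ddx q x * f x)"

definition kdv_phi :: "(real \<Rightarrow> complex) \<Rightarrow> nat \<Rightarrow> complex \<Rightarrow> real \<Rightarrow> complex" where
  "kdv_phi q n l x = (\<Sum>j\<le>n. (4 * l) ^ (n - j) * kdv_F q j x)"

text \<open>
  \<open>\<psi> l x\<close> is the value of the candidate soliton at parameter \<open>l\<close> (the spectral parameter
  $\lambda$) and point \<open>x\<close>. The coefficient $A_{i-1}$ is \<open>A i\<close>. A polynomial identity in
  $\lambda$ is stated as an identity for every complex value of $\lambda$.
\<close>

definition is_soliton ::
  "real set \<Rightarrow> (real \<Rightarrow> complex) \<Rightarrow> nat \<Rightarrow> (complex \<Rightarrow> real \<Rightarrow> complex) \<Rightarrow> bool" where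
  "is_soliton I q n \<psi> \<longleftrightarrow>
     (\<exists>A :: nat \<Rightarrow> real \<Rightarrow> complex.
        (\<exists>c. c \<noteq> 0 \<and> (\<forall>x\<in>I. A 0 x = c)) \<and>
        (\<forall>i\<in>{1..n}. smooth_on_open I (A i)) \<and>
        (\<forall>l. \<forall>x\<in>I. \<psi> l x = (\<Sum>i\<le>n. A i x * (4 * l) ^ (n - i)))) \<and>
     (\<forall>l. \<forall>x\<in>I. kdv_B q (\<psi> l) x = 4 * l * ddx (\<psi> l) x)"

end

theory Submission imports Defs
begin

text \<open>
  That \<open>B(F\<^sub>n)\<close> is a total derivative comes from the first integral
  \<open>2 f f'' - f'\<^sup>2 + 4 q f\<^sup>2 - z f\<^sup>2\<close> of \<open>B(f) = z f'\<close>. Evaluated on the generating series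
  \<open>\<Sum> F\<^bsub>j-1\<^esub> z\<^bsup>-j\<^esup>\<close>, it yields a recursion which determines each coefficient algebraically from the
  earlier ones, and the coefficients so obtained solve \<open>F\<^bsub>n+1\<^esub>' = B(F\<^sub>n)\<close>. The telescoping identity
  \<open>B(\<phi>\<^sub>k) - z \<phi>\<^sub>k' = F\<^bsub>k\<^esub>'\<close> with \<open>z = 4\<lambda>\<close> then gives the soliton criterion. Conversely, comparing powers
  of \<open>z\<close> for a soliton gives \<open>A\<^bsub>i+1\<^esub>' = B(A\<^sub>i)\<close>, and each integration adds a constant multiple of
  \<open>F\<^bsub>-1\<^esub>\<close>.
\<close>

section \<open>Differential polynomials\<close>

text \<open>Reduces additive identities to single terms; applied in both factors, it reduces
  bilinear ones to pairs of monomials.\<close>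

lemma poly_mapping_single_induct [case_names single add]:
  assumes "\<And>k v. P (Poly_Mapping.single k v)" and "\<And>p q. P p \<Longrightarrow> P q \<Longrightarrow> P (p + q)"
  shows "P p"
proof (induction p rule: Poly_Mapping.update_induct)
  case const
  show ?case using assms(1)[of undefined 0] by simp
next
  case (update f a b)
  have "Poly_Mapping.update a b f = f + Poly_Mapping.single a b"
    using update(1)
    by (intro poly_mapping_eqI)
       (auto simp: lookup_update lookup_add lookup_single when_def in_keys_iff)
  then show ?case using assms update by auto
qed

text \<open>Exponents are natural numbers, so two monomials multiply to \<open>0\<close>, the
  monomial 1, only if both are \<open>0\<close>.\<close>

lemma lookup_mult_0:
  fixes p q :: diffpoly
  shows "Poly_Mapping.lookup (p * q) 0 = Poly_Mapping.lookup p 0 * Poly_Mapping.lookup q 0"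
proof (induction p rule: poly_mapping_single_induct)
  case (single k v)
  show ?case
  proof (induction q rule: poly_mapping_single_induct)
    case (single l w)
    have "k + l = 0 \<longleftrightarrow> k = 0 \<and> l = 0"
      by (auto simp: poly_mapping_eq_iff lookup_add fun_eq_iff)
    then show ?case by (auto simp: mult_single lookup_single when_def)
  qed (simp add: lookup_add algebra_simps)
qed (simp add: lookup_add algebra_simps)

text \<open>Isolates the contribution of one monomial. It is additive in \<open>c\<close>, which
  gives additivity of \<open>dp_deriv\<close> even when keys of a sum cancel.\<close>

definition dp_term_deriv :: "(nat \<Rightarrow>\<^sub>0 nat) \<Rightarrow> complex \<Rightarrow> diffpoly" where
  "dp_term_deriv m c = (\<Sum>k\<in>Poly_Mapping.keys m.
     Poly_Mapping.single (m - Poly_Mapping.single k 1 + Poly_Mapping.single (Suc k) 1)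
       (of_nat (Poly_Mapping.lookup m k) * c))"

lemma dp_deriv_eq_sum_terms:
  "dp_deriv P = (\<Sum>m\<in>Poly_Mapping.keys P. dp_term_deriv m (Poly_Mapping.lookup P m))"
  by (simp add: dp_deriv_def dp_term_deriv_def)

lemma dp_term_deriv_0 [simp]: "dp_term_deriv m 0 = 0"
  by (simp add: dp_term_deriv_def)

lemma dp_term_deriv_add: "dp_term_deriv m (a + b) = dp_term_deriv m a + dp_term_deriv m b"
  by (simp add: dp_term_deriv_def distrib_left single_add sum.distrib)

text \<open>The factor \<open>lookup m k\<close> vanishes off the keys. This lets \<open>m\<close>,
  \<open>n\<close> and \<open>m + n\<close> share one index set in the product rule.\<close>

lemma dp_term_deriv_superset:
  assumes "finite K" "Poly_Mapping.keys m \<subseteq> K"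
  shows "dp_term_deriv m c = (\<Sum>k\<in>K.
     Poly_Mapping.single (m - Poly_Mapping.single k 1 + Poly_Mapping.single (Suc k) 1)
       (of_nat (Poly_Mapping.lookup m k) * c))"
  unfolding dp_term_deriv_def using assms
  by (intro sum.mono_neutral_left) (auto simp: in_keys_iff)

lemma dp_deriv_single [simp]: "dp_deriv (Poly_Mapping.single m c) = dp_term_deriv m c"
  by (cases "c = 0") (simp_all add: dp_deriv_eq_sum_terms)

lemma dp_deriv_add: "dp_deriv (P + Q) = dp_deriv P + dp_deriv Q"
  unfolding dp_deriv_eq_sum_terms
  by (rule setsum_keys_plus_distrib) (simp_all add: dp_term_deriv_add)

text \<open>Subtraction of exponents is truncated; the assumption guarantees that a factor
  \<open>k\<close> can really be taken out of \<open>m\<close>.\<close>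

lemma shift_add_left:
  fixes m n :: "nat \<Rightarrow>\<^sub>0 nat"
  assumes "Poly_Mapping.lookup m k \<noteq> 0"
  shows "m + n - Poly_Mapping.single k 1 + s = (m - Poly_Mapping.single k 1 + s) + n"
  using assms by (intro poly_mapping_eqI) (auto simp: lookup_add lookup_minus lookup_single when_def)

text \<open>Leibniz rule on monomials: the weight of \<open>k\<close> in \<open>m + n\<close> is the
  sum of its exponents in \<open>m\<close> and \<open>n\<close>, and each part yields one of the two
  products.\<close>

lemma dp_term_deriv_mult:
  "dp_term_deriv (m + n) (a * b) =
     dp_term_deriv m a * Poly_Mapping.single n b + Poly_Mapping.single m a * dp_term_deriv n b"
proof -
  let ?K = "Poly_Mapping.keys m \<union> Poly_Mapping.keys n"
  let ?s = "\<lambda>m k. m - Poly_Mapping.single k 1 + Poly_Mapping.single (Suc k) (1::nat)"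
  have *: "Poly_Mapping.single (?s (m + n) k) (of_nat (Poly_Mapping.lookup (m + n) k) * (a * b)) =
      Poly_Mapping.single (?s m k) (of_nat (Poly_Mapping.lookup m k) * a) * Poly_Mapping.single n b +
      Poly_Mapping.single m a * Poly_Mapping.single (?s n k) (of_nat (Poly_Mapping.lookup n k) * b)"
    for k
  proof -
    have l: "Poly_Mapping.single (?s (m + n) k) (of_nat (Poly_Mapping.lookup m k) * (a * b)) =
      Poly_Mapping.single (?s m k) (of_nat (Poly_Mapping.lookup m k) * a) * Poly_Mapping.single n b"
      using shift_add_left[of m k n "Poly_Mapping.single (Suc k) 1"]
      by (cases "Poly_Mapping.lookup m k = 0") (simp_all add: mult_single mult.assoc)
    have r: "Poly_Mapping.single (?s (m + n) k) (of_nat (Poly_Mapping.lookup n k) * (a * b)) =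
      Poly_Mapping.single m a * Poly_Mapping.single (?s n k) (of_nat (Poly_Mapping.lookup n k) * b)"
      using shift_add_left[of n k m "Poly_Mapping.single (Suc k) 1"]
      by (cases "Poly_Mapping.lookup n k = 0") (simp_all add: mult_single mult.left_commute add.commute)
    show ?thesis
      unfolding l[symmetric] r[symmetric]
      by (simp add: lookup_add single_add[symmetric] distrib_right)
  qed
  have keys: "Poly_Mapping.keys (m + n) \<subseteq> ?K"
    by (rule Poly_Mapping.keys_add)
  have "dp_term_deriv (m + n) (a * b) = (\<Sum>k\<in>?K. Poly_Mapping.single (?s (m + n) k)
      (of_nat (Poly_Mapping.lookup (m + n) k) * (a * b)))"
    using keys by (intro dp_term_deriv_superset) auto
  also have "\<dots> = dp_term_deriv m a * Poly_Mapping.single n b +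
      Poly_Mapping.single m a * dp_term_deriv n b"
    by (simp only: * sum.distrib sum_distrib_left sum_distrib_right
        dp_term_deriv_superset[of ?K m] dp_term_deriv_superset[of ?K n]
        finite_UnI finite_keys Un_upper1 Un_upper2)
  finally show ?thesis .
qed

lemma dp_deriv_mult: "dp_deriv (P * Q) = dp_deriv P * Q + P * dp_deriv Q"
proof (induction P rule: poly_mapping_single_induct)
  case (single m a)
  show ?case
    by (induction Q rule: poly_mapping_single_induct)
       (simp_all add: mult_single dp_term_deriv_mult dp_deriv_add algebra_simps)
qed (simp add: dp_deriv_add algebra_simps)

lemma dp_deriv_const [simp]: "dp_deriv (dp_const c) = 0"
  by (simp add: dp_const_def dp_term_deriv_def)

lemma dp_deriv_var [simp]: "dp_deriv (dp_var k) = dp_var (Suc k)"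
  by (simp add: dp_var_def dp_term_deriv_def)

lemma dp_deriv_0 [simp]: "dp_deriv 0 = 0"
  by (simp add: dp_deriv_def)

lemma dp_deriv_numeral [simp]: "dp_deriv (numeral w) = 0"
  using dp_deriv_const[of "numeral w"] by (simp add: dp_const_def)

lemma dp_deriv_diff: "dp_deriv (P - Q) = dp_deriv P - dp_deriv Q"
  using dp_deriv_add[of "P - Q" Q] by simp

lemma dp_deriv_sum: "dp_deriv (sum f A) = (\<Sum>i\<in>A. dp_deriv (f i))"
  by (induction A rule: infinite_finite_induct) (auto simp: dp_deriv_add)

lemma lookup_dp_deriv_0 [simp]: "Poly_Mapping.lookup (dp_deriv P) 0 = 0"
proof -
  have "m + Poly_Mapping.single (Suc k) 1 \<noteq> 0" for m :: "nat \<Rightarrow>\<^sub>0 nat" and k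
    by (auto simp: poly_mapping_eq_iff lookup_add fun_eq_iff intro!: exI[of _ "Suc k"])
  then show ?thesis
    by (simp add: dp_deriv_def lookup_sum lookup_single when_def)
qed

text \<open>If a variable occurs in \<open>P\<close>, take the one of highest order \<open>K\<close>
  and a monomial \<open>m\<close> containing it. Trading a factor \<open>K\<close> for
  \<open>K + 1\<close> gives a monomial that arises from no other term, with coefficient the
  exponent of \<open>K\<close> times that of \<open>m\<close>, so nothing can cancel it.\<close>

lemma dp_deriv_eq_0_iff: "dp_deriv P = 0 \<longleftrightarrow> (\<exists>c. P = dp_const c)"
proof
  assume P: "dp_deriv P = 0"
  let ?V = "\<Union>m\<in>Poly_Mapping.keys P. Poly_Mapping.keys m"
  have "?V = {}"
  proof (rule ccontr)
    assume "?V \<noteq> {}"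
    define K where "K = Max ?V"
    have fin: "finite ?V" by simp
    have "K \<in> ?V" unfolding K_def using Max_in[OF fin \<open>?V \<noteq> {}\<close>] .
    then obtain m where m: "m \<in> Poly_Mapping.keys P" "K \<in> Poly_Mapping.keys m" by blast
    have top: "Poly_Mapping.lookup m' (Suc K) = 0" if "m' \<in> Poly_Mapping.keys P" for m'
    proof (rule ccontr)
      assume "Poly_Mapping.lookup m' (Suc K) \<noteq> 0"
      then have "Suc K \<in> ?V" using that by (auto simp: in_keys_iff)
      then have "Suc K \<le> K" unfolding K_def using fin by (intro Max_ge)
      then show False by simp
    qed
    let ?s = "\<lambda>m k. m - Poly_Mapping.single k 1 + Poly_Mapping.single (Suc k) (1::nat)"
    \<comment> \<open>The variable \<open>K + 1\<close> can only have come from differentiating a factor \<open>K\<close>.\<close>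
    have unique: "?s m' k = ?s m K \<longleftrightarrow> m' = m \<and> k = K"
      if m': "m' \<in> Poly_Mapping.keys P" and k: "k \<in> Poly_Mapping.keys m'" for m' k
    proof
      assume eq: "?s m' k = ?s m K"
      have "Poly_Mapping.lookup (?s m' k) (Suc K) = Poly_Mapping.lookup (?s m K) (Suc K)"
        by (simp only: eq)
      then have kK: "k = K"
        using top[OF m'] top[OF m(1)]
        by (auto simp: lookup_add lookup_minus lookup_single when_def split: if_splits)
      have "Poly_Mapping.lookup m' i = Poly_Mapping.lookup m i" for i
      proof -
        have "m' - Poly_Mapping.single K 1 = m - Poly_Mapping.single K 1"
          using eq kK by simp
        then have "Poly_Mapping.lookup (m' - Poly_Mapping.single K 1) i =
            Poly_Mapping.lookup (m - Poly_Mapping.single K 1) i" by simp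
        \<comment> \<open>Both exponents of \<open>K\<close> are positive, so the truncated
          subtraction can be undone.\<close>
        then show ?thesis
          using k m(2) kK by (auto simp: lookup_minus lookup_single when_def in_keys_iff split: if_splits)
      qed
      then show "m' = m \<and> k = K" using kK by (auto intro: poly_mapping_eqI)
    qed auto
    have "0 = Poly_Mapping.lookup (dp_deriv P) (?s m K)" by (simp add: P)
    also have "\<dots> = (\<Sum>m'\<in>Poly_Mapping.keys P. \<Sum>k\<in>Poly_Mapping.keys m'.
        (if m' = m \<and> k = K
         then of_nat (Poly_Mapping.lookup m' k) * Poly_Mapping.lookup P m' else 0))"
      unfolding dp_deriv_def lookup_sum lookup_single when_def
      by (intro sum.cong refl if_cong unique) auto
    also have "\<dots> = (\<Sum>m'\<in>Poly_Mapping.keys P. if m' = m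
         then of_nat (Poly_Mapping.lookup m K) * Poly_Mapping.lookup P m else 0)"
      using m(2) by (intro sum.cong) auto
    also have "\<dots> = of_nat (Poly_Mapping.lookup m K) * Poly_Mapping.lookup P m"
      using m(1) by simp
    finally show False using m by (simp add: in_keys_iff)
  qed
  then have "m = 0" if "m \<in> Poly_Mapping.keys P" for m
    using that by (auto intro!: poly_mapping_eqI simp: in_keys_iff)
  then have "P = dp_const (Poly_Mapping.lookup P 0)"
    unfolding dp_const_def
    by (intro poly_mapping_eqI) (auto simp: lookup_single when_def in_keys_iff)
  then show "\<exists>c. P = dp_const c" ..
qed auto

text \<open>Supplies the uniqueness half of the definite description in \<open>dp_F\<close>.\<close>

lemma dp_deriv_inj:
  assumes "dp_deriv P = dp_deriv Q" "Poly_Mapping.lookup P 0 = Poly_Mapping.lookup Q 0"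
  shows "P = Q"
proof -
  have "dp_deriv (P - Q) = 0" using assms(1) by (simp add: dp_deriv_diff)
  then obtain c where c: "P - Q = dp_const c" by (auto simp: dp_deriv_eq_0_iff)
  then have "c = Poly_Mapping.lookup (P - Q) 0" by (simp add: dp_const_def)
  then have "c = 0" by (simp add: lookup_minus assms(2))
  then show ?thesis using c by (simp add: dp_const_def)
qed

section \<open>Integrability of the recursion\<close>

text \<open>
  The coefficient of \<open>z\<^bsup>-n\<^esup>\<close> in the first integral of the generating series, set to zero and solved
  for the term \<open>2 F\<^bsub>-1\<^esub> F\<^sub>n\<close>; the shifted index is that of \<^const>\<open>dp_F\<close>.
\<close>

fun kdv_G :: "nat \<Rightarrow> diffpoly" where
  "kdv_G 0 = dp_const (1/2)"
| "kdv_G (Suc n) =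
     (\<Sum>i\<le>n. 2 * kdv_G i * dp_deriv (dp_deriv (kdv_G (n - i)))
            - dp_deriv (kdv_G i) * dp_deriv (kdv_G (n - i))
            + 4 * dp_var 0 * kdv_G i * kdv_G (n - i))
     - (\<Sum>i\<in>{1..n}. kdv_G i * kdv_G (Suc n - i))"

text \<open>Differentiating the defining recursion turns both convolutions into sums of
  \<open>2 * kdv_G i * dp_B (kdv_G (n - i))\<close>, over \<open>i \<le> n\<close> and, by
  induction, over \<open>1 \<le> i \<le> n\<close>. Only the term \<open>i = 0\<close> survives, and
  \<open>2 * kdv_G 0 = 1\<close>.\<close>

lemma dp_deriv_kdv_G_Suc: "dp_deriv (kdv_G (Suc n)) = dp_B (kdv_G n)"
proof (induction n rule: less_induct)
  case (less n)
  let ?G = kdv_G and ?D = dp_deriv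
  have swap: "(\<Sum>i\<le>n. f (n - i) i) = (\<Sum>i\<le>n. f i (n - i))" for f :: "nat \<Rightarrow> nat \<Rightarrow> diffpoly"
    using sum.nat_diff_reindex[of "\<lambda>i. f i (n - i)" "Suc n"]
    by (simp add: lessThan_Suc_atMost)
  have quad: "?D (\<Sum>i\<le>n. 2 * ?G i * ?D (?D (?G (n - i))) - ?D (?G i) * ?D (?G (n - i))
            + 4 * dp_var 0 * ?G i * ?G (n - i)) = (\<Sum>i\<le>n. 2 * ?G i * dp_B (?G (n - i)))"
  proof -
    have s1: "(\<Sum>i\<le>n. ?D (?D (?G i)) * ?D (?G (n - i))) = (\<Sum>i\<le>n. ?D (?G i) * ?D (?D (?G (n - i))))"
      using swap[of "\<lambda>i j. ?D (?G i) * ?D (?D (?G j))"] by (simp add: mult.commute)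
    have s2: "(\<Sum>i\<le>n. ?D (?G i) * ?G (n - i)) = (\<Sum>i\<le>n. ?G i * ?D (?G (n - i)))"
      using swap[of "\<lambda>i j. ?G i * ?D (?G j)"] by (simp add: mult.commute)
    \<comment> \<open>The two bracketed remainders are antisymmetric under exchanging
      \<open>i\<close> and \<open>n - i\<close>, hence cancel in the sum.\<close>
    have "?D (\<Sum>i\<le>n. 2 * ?G i * ?D (?D (?G (n - i))) - ?D (?G i) * ?D (?G (n - i))
            + 4 * dp_var 0 * ?G i * ?G (n - i)) =
        (\<Sum>i\<le>n. 2 * ?G i * dp_B (?G (n - i))
           + (?D (?G i) * ?D (?D (?G (n - i))) - ?D (?D (?G i)) * ?D (?G (n - i)))
           + 4 * dp_var 0 * (?D (?G i) * ?G (n - i) - ?G i * ?D (?G (n - i))))"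
      unfolding dp_deriv_sum
      by (intro sum.cong)
         (simp_all add: dp_deriv_add dp_deriv_diff dp_deriv_mult dp_B_def numeral_3_eq_3 algebra_simps)
    also have "\<dots> = (\<Sum>i\<le>n. 2 * ?G i * dp_B (?G (n - i)))"
      by (simp add: sum.distrib sum_subtractf s1 s2 flip: sum_distrib_left)
    finally show ?thesis .
  qed
  have "?D (\<Sum>i\<in>{1..n}. ?G i * ?G (Suc n - i)) = (\<Sum>i\<in>{1..n}. 2 * ?G i * dp_B (?G (n - i)))"
  proof -
    \<comment> \<open>The reflection of \<open>i\<close> to \<open>n + 1 - i\<close> identifies the
      two halves of the product rule.\<close>
    have "(\<Sum>i\<in>{1..n}. ?D (?G i) * ?G (Suc n - i)) = (\<Sum>i\<in>{1..n}. ?G i * ?D (?G (Suc n - i)))"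
      using sum.atLeastAtMost_rev[of "\<lambda>i. ?D (?G i) * ?G (Suc n - i)" 1 n]
      by (auto simp: mult.commute intro!: sum.cong)
    then have "?D (\<Sum>i\<in>{1..n}. ?G i * ?G (Suc n - i)) = (\<Sum>i\<in>{1..n}. 2 * ?G i * ?D (?G (Suc n - i)))"
      by (simp add: dp_deriv_sum dp_deriv_mult sum.distrib mult.assoc flip: sum_distrib_left)
    also have "\<dots> = (\<Sum>i\<in>{1..n}. 2 * ?G i * dp_B (?G (n - i)))"
    proof (intro sum.cong refl)
      fix i assume i: "i \<in> {1..n}"
      \<comment> \<open>The induction hypothesis applies because \<open>i \<ge> 1\<close> makes
        \<open>n - i < n\<close>.\<close>
      then have "?D (?G (Suc (n - i))) = dp_B (?G (n - i))" by (intro less.IH) auto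
      then show "2 * ?G i * ?D (?G (Suc n - i)) = 2 * ?G i * dp_B (?G (n - i))"
        using i by (simp only: Suc_diff_le atLeastAtMost_iff)
    qed
    finally show ?thesis .
  qed
  then have "?D (?G (Suc n)) =
      (\<Sum>i\<le>n. 2 * ?G i * dp_B (?G (n - i))) - (\<Sum>i\<in>{1..n}. 2 * ?G i * dp_B (?G (n - i)))"
    by (simp only: kdv_G.simps(2) dp_deriv_diff quad)
  also have "\<dots> = 2 * ?G 0 * dp_B (?G n)"
    by (simp add: atMost_atLeast0 sum.atLeast_Suc_atMost[of 0 n])
  also have "2 * ?G 0 = 1"
    by (simp add: dp_const_def mult_single flip: single_numeral single_one)
  finally show ?case by simp
qed

text \<open>Every summand of the recursion contains a derivative, the variable
  \<open>dp_var 0\<close>, or an earlier \<open>kdv_G i\<close> with \<open>i \<ge> 1\<close>, each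
  without constant term.\<close>

lemma lookup_kdv_G_Suc_0 [simp]: "Poly_Mapping.lookup (kdv_G (Suc n)) 0 = 0"
proof (induction n rule: less_induct)
  case (less n)
  have "Poly_Mapping.lookup (kdv_G i) 0 = 0" if "i \<in> {1..n}" for i
    using less.IH[of "i - 1"] that by (auto simp del: kdv_G.simps)
  moreover have "Poly_Mapping.lookup (dp_var 0) 0 = 0"
    by (simp add: dp_var_def lookup_single when_def poly_mapping_eq_iff fun_eq_iff)
  ultimately show ?case
    by (simp add: lookup_minus lookup_sum lookup_add lookup_mult_0)
qed

text \<open>The explicit solution \<open>kdv_G\<close> provides the existence without which the
  \<open>THE\<close> in \<open>dp_F\<close> would say nothing.\<close>

lemma dp_F_eq_kdv_G: "dp_F j = kdv_G j"
proof (induction j)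
  case (Suc j)
  have "(THE P. dp_deriv P = dp_B (kdv_G j) \<and> Poly_Mapping.lookup P 0 = 0) = kdv_G (Suc j)"
    using dp_deriv_kdv_G_Suc[of j] lookup_kdv_G_Suc_0[of j]
    by (intro the_equality) (auto intro: dp_deriv_inj simp del: kdv_G.simps)
  then show ?case using Suc by (simp del: kdv_G.simps)
qed simp

lemma dp_deriv_dp_F_Suc: "dp_deriv (dp_F (Suc j)) = dp_B (dp_F j)"
  by (simp only: dp_F_eq_kdv_G dp_deriv_kdv_G_Suc)

section \<open>Linearity of B and the telescoping identity\<close>

lemma dp_deriv_scale: "dp_deriv (dp_const c * P) = dp_const c * dp_deriv P"
  by (simp add: dp_deriv_mult)

lemma dp_B_add: "dp_B (P + Q) = dp_B P + dp_B Q"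
  by (simp add: dp_B_def numeral_3_eq_3 dp_deriv_add algebra_simps)

lemma dp_B_scale: "dp_B (dp_const c * P) = dp_const c * dp_B P"
  by (simp add: dp_B_def numeral_3_eq_3 dp_deriv_scale distrib_left mult.left_commute)

lemma dp_B_0 [simp]: "dp_B 0 = 0"
  by (simp add: dp_B_def numeral_3_eq_3)

lemma dp_B_sum: "dp_B (sum f A) = (\<Sum>i\<in>A. dp_B (f i))"
  by (induction A rule: infinite_finite_induct) (auto simp: dp_B_add)

lemma dp_const_mult: "dp_const a * dp_const b = dp_const (a * b)"
  by (simp add: dp_const_def mult_single)

lemma dp_const_1 [simp]: "dp_const 1 = 1"
  by (simp add: dp_const_def)

definition dp_phi :: "complex \<Rightarrow> nat \<Rightarrow> diffpoly" where
  "dp_phi z k = (\<Sum>j\<le>k. dp_const (z ^ (k - j)) * dp_F j)"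

lemma dp_phi_0: "dp_phi z 0 = dp_F 0"
  by (simp add: dp_phi_def)

text \<open>Horner's scheme in \<open>z\<close>, the form that drives the induction for the
  telescoping identity.\<close>

lemma dp_phi_Suc: "dp_phi z (Suc k) = dp_const z * dp_phi z k + dp_F (Suc k)"
proof -
  have "(\<Sum>j\<le>k. dp_const (z ^ (Suc k - j)) * dp_F j) = dp_const z * dp_phi z k"
    by (simp add: dp_phi_def sum_distrib_left Suc_diff_le mult.assoc[symmetric] dp_const_mult)
  then show ?thesis by (simp add: dp_phi_def del: dp_F.simps)
qed

lemma dp_B_phi: "dp_B (dp_phi z k) - dp_const z * dp_deriv (dp_phi z k) = dp_deriv (dp_F (Suc k))"
proof (induction k)
  case 0
  show ?case
    by (simp add: dp_phi_0 dp_deriv_dp_F_Suc del: dp_F.simps(2))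
next
  case (Suc k)
  have "dp_B (dp_phi z (Suc k)) - dp_const z * dp_deriv (dp_phi z (Suc k)) =
      dp_const z * (dp_B (dp_phi z k) - dp_const z * dp_deriv (dp_phi z k))
      + dp_B (dp_F (Suc k)) - dp_const z * dp_deriv (dp_F (Suc k))"
    by (simp add: dp_phi_Suc dp_B_add dp_B_scale dp_deriv_add dp_deriv_scale
        right_diff_distrib distrib_left del: dp_F.simps)
  \<comment> \<open>The induction hypothesis contributes \<open>z\<close> times the derivative of
    \<open>dp_F (Suc k)\<close>, which cancels the last term and leaves
    \<open>dp_B (dp_F (Suc k))\<close>.\<close>
  then show ?case
    by (simp add: Suc.IH dp_deriv_dp_F_Suc[of "Suc k"] del: dp_F.simps)
qed

section \<open>Evaluation at a smooth function\<close>

definition dp_mono_eval :: "(nat \<Rightarrow>\<^sub>0 nat) \<Rightarrow> (real \<Rightarrow> complex) \<Rightarrow> real \<Rightarrow> complex" where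
  "dp_mono_eval m q x = (\<Prod>k\<in>Poly_Mapping.keys m. ((ddx ^^ k) q x) ^ Poly_Mapping.lookup m k)"

lemma dp_eval_eq_sum_mono:
  "dp_eval P q x = (\<Sum>m\<in>Poly_Mapping.keys P. Poly_Mapping.lookup P m * dp_mono_eval m q x)"
  by (simp add: dp_eval_def dp_mono_eval_def)

lemma dp_mono_eval_superset:
  assumes "finite K" "Poly_Mapping.keys m \<subseteq> K"
  shows "dp_mono_eval m q x = (\<Prod>k\<in>K. ((ddx ^^ k) q x) ^ Poly_Mapping.lookup m k)"
  unfolding dp_mono_eval_def using assms
  by (intro prod.mono_neutral_left) (auto simp: in_keys_iff)

lemma dp_mono_eval_add: "dp_mono_eval (m + n) q x = dp_mono_eval m q x * dp_mono_eval n q x"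
proof -
  let ?K = "Poly_Mapping.keys m \<union> Poly_Mapping.keys n"
  show ?thesis
    using Poly_Mapping.keys_add[of m n]
    by (simp add: dp_mono_eval_superset[of ?K] lookup_add power_add prod.distrib)
qed

lemma dp_eval_add: "dp_eval (P + Q) q x = dp_eval P q x + dp_eval Q q x"
  unfolding dp_eval_eq_sum_mono
  by (rule setsum_keys_plus_distrib) (simp_all add: distrib_right)

lemma dp_eval_single: "dp_eval (Poly_Mapping.single m c) q x = c * dp_mono_eval m q x"
  by (cases "c = 0") (simp_all add: dp_eval_eq_sum_mono)

lemma dp_eval_mult: "dp_eval (P * Q) q x = dp_eval P q x * dp_eval Q q x"
proof (induction P rule: poly_mapping_single_induct)
  case (single m a)
  show ?case
    by (induction Q rule: poly_mapping_single_induct)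
       (simp_all add: mult_single dp_eval_single dp_mono_eval_add dp_eval_add algebra_simps)
qed (simp add: dp_eval_add algebra_simps)

lemma dp_eval_const [simp]: "dp_eval (dp_const c) q x = c"
  by (simp add: dp_const_def dp_eval_single dp_mono_eval_def)

lemma dp_eval_0 [simp]: "dp_eval 0 q x = 0"
  by (simp add: dp_eval_def)

lemma dp_eval_numeral [simp]: "dp_eval (numeral w) q x = numeral w"
  using dp_eval_const[of "numeral w" q x] by (simp add: dp_const_def)

lemma dp_eval_var [simp]: "dp_eval (dp_var k) q x = (ddx ^^ k) q x"
  by (simp add: dp_var_def dp_eval_single dp_mono_eval_def)

lemma dp_eval_diff: "dp_eval (P - Q) q x = dp_eval P q x - dp_eval Q q x"
  using dp_eval_add[of "P - Q" Q q x] by simp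

lemma dp_eval_sum: "dp_eval (sum f A) q x = (\<Sum>i\<in>A. dp_eval (f i) q x)"
  by (induction A rule: infinite_finite_induct) (auto simp: dp_eval_add)

lemma dp_eval_phi: "dp_eval (dp_phi (4 * l) k) q x = kdv_phi q k l x"
  by (simp add: dp_phi_def kdv_phi_def kdv_F_def dp_eval_sum dp_eval_mult)

text \<open>Constants and variables generate the ring; claims closed under sums and products need
  checking only there.\<close>

lemma diffpoly_induct [case_names const var add mult]:
  assumes const: "\<And>c. S (dp_const c)" and var: "\<And>k. S (dp_var k)"
    and add: "\<And>P Q. S P \<Longrightarrow> S Q \<Longrightarrow> S (P + Q)"
    and mult: "\<And>P Q. S P \<Longrightarrow> S Q \<Longrightarrow> S (P * Q)"
  shows "S P"
proof (induction P rule: poly_mapping_single_induct)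
  case (single m c)
  show ?case
  proof (induction m arbitrary: c rule: poly_mapping_single_induct)
    case (single k e)
    show ?case
    proof (induction e arbitrary: c)
      case 0
      show ?case using const[of c] by (simp add: dp_const_def)
    next
      case (Suc e)
      have "Poly_Mapping.single (Poly_Mapping.single k (Suc e)) c =
          Poly_Mapping.single (Poly_Mapping.single k e) c * dp_var k"
        by (simp add: dp_var_def mult_single flip: single_add)
      then show ?case using mult[OF Suc[of c] var] by simp
    qed
  next
    case (add m n)
    \<comment> \<open>The coefficient goes entirely into the first factor, hence the induction over
      arbitrary \<open>c\<close>.\<close>
    have "Poly_Mapping.single (m + n) c = Poly_Mapping.single m c * Poly_Mapping.single n 1"
      by (simp add: mult_single)
    then show ?case using mult[OF add.IH] by simp
  qed
qed (rule add)

text \<open>Formal and analytic derivatives obey the same sum and product rules, so they agree once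
  they agree on generators; smoothness of \<open>q\<close> settles the variables.\<close>

lemma has_vector_derivative_dp_eval:
  assumes "smooth_on_open I q" "x \<in> I"
  shows "(dp_eval P q has_vector_derivative dp_eval (dp_deriv P) q x) (at x)"
proof (induction P rule: diffpoly_induct)
  case (const c)
  have "dp_eval (dp_const c) q = (\<lambda>x. c)" by auto
  then show ?case by simp
next
  case (var k)
  have "(ddx ^^ k) q differentiable (at x)" using assms by (auto simp: smooth_on_open_def)
  moreover have "dp_eval (dp_var k) q = (ddx ^^ k) q" by auto
  ultimately show ?case by (simp add: vector_derivative_works)
next
  case (add P Q)
  have "dp_eval (P + Q) q = (\<lambda>x. dp_eval P q x + dp_eval Q q x)" by (auto simp: dp_eval_add)
  then show ?case
    using has_vector_derivative_add[OF add] by (simp add: dp_deriv_add dp_eval_add)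
next
  case (mult P Q)
  have "dp_eval (P * Q) q = (\<lambda>x. dp_eval P q x * dp_eval Q q x)" by (auto simp: dp_eval_mult)
  then show ?case
    using has_vector_derivative_mult[OF mult]
    by (simp add: dp_deriv_mult dp_eval_add dp_eval_mult add.commute)
qed

section \<open>Locality of derivatives and of B on an open set\<close>

lemma funpow_ddx_cong:
  assumes "open I" "\<And>x. x \<in> I \<Longrightarrow> f x = g x" "x \<in> I"
  shows "(ddx ^^ k) f x = (ddx ^^ k) g x"
  using assms(3)
proof (induction k arbitrary: x)
  case (Suc k)
  have "eventually (\<lambda>y. y \<in> UNIV \<longrightarrow> (ddx ^^ k) f y = (ddx ^^ k) g y) (nhds x)"
    using Suc assms(1) by (auto simp: eventually_nhds)
  then show ?case by (auto intro: vector_derivative_cong_eq)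
qed (auto simp: assms)

text \<open>Identifies iterated derivatives from a candidate sequence \<open>d\<close>; the
  functions may differ off \<open>I\<close>, so each step uses locality.\<close>

lemma funpow_ddx_eq:
  assumes "open I" "\<And>k x. x \<in> I \<Longrightarrow> (d k has_vector_derivative d (Suc k) x) (at x)" "x \<in> I"
  shows "(ddx ^^ k) (d 0) x = d k x"
  using assms(3)
proof (induction k arbitrary: x)
  case (Suc k)
  have "ddx ((ddx ^^ k) (d 0)) x = ddx (d k) x"
    using funpow_ddx_cong[OF assms(1), of "(ddx ^^ k) (d 0)" "d k" x 1] Suc by simp
  also have "\<dots> = d (Suc k) x"
    using assms(2) Suc.prems by (intro vector_derivative_at)
  finally show ?case by simp
qed auto

lemma smooth_on_open_cong:
  assumes "open I" "\<And>x. x \<in> I \<Longrightarrow> f x = g x" "smooth_on_open I f"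
  shows "smooth_on_open I g"
  unfolding smooth_on_open_def
proof safe
  fix k x assume x: "x \<in> I"
  have "((ddx ^^ k) f has_vector_derivative ddx ((ddx ^^ k) f) x) (at x)"
    using assms(3) x by (auto simp: smooth_on_open_def vector_derivative_works)
  then have "((ddx ^^ k) g has_vector_derivative ddx ((ddx ^^ k) f) x) (at x)"
    by (rule has_vector_derivative_transform_within_open[OF _ assms(1) x])
       (rule funpow_ddx_cong[OF assms(1,2)])
  then show "(ddx ^^ k) g differentiable (at x)"
    by (rule differentiableI_vector)
qed

lemma funpow_ddx_dp_eval:
  assumes "open I" "smooth_on_open I q" "x \<in> I"
  shows "(ddx ^^ k) (dp_eval P q) x = dp_eval ((dp_deriv ^^ k) P) q x"
  using funpow_ddx_eq[of I "\<lambda>k. dp_eval ((dp_deriv ^^ k) P) q" x k]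
    has_vector_derivative_dp_eval[OF assms(2)] assms by simp

lemma smooth_on_open_dp_eval:
  assumes "open I" "smooth_on_open I q"
  shows "smooth_on_open I (dp_eval P q)"
  unfolding smooth_on_open_def
proof safe
  fix k x assume x: "x \<in> I"
  have "((ddx ^^ k) (dp_eval P q) has_vector_derivative dp_eval (dp_deriv ((dp_deriv ^^ k) P)) q x) (at x)"
    by (rule has_vector_derivative_transform_within_open
          [OF has_vector_derivative_dp_eval[OF assms(2) x] assms(1) x])
       (simp add: funpow_ddx_dp_eval[OF assms])
  then show "(ddx ^^ k) (dp_eval P q) differentiable (at x)"
    by (rule differentiableI_vector)
qed

lemma kdv_B_cong:
  assumes "open I" "\<And>x. x \<in> I \<Longrightarrow> f x = g x" "x \<in> I"
  shows "kdv_B q f x = kdv_B q g x"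
  using funpow_ddx_cong[OF assms, where k = 3] funpow_ddx_cong[OF assms, where k = 1] assms(2,3)
  by (simp add: kdv_B_def)

lemma kdv_B_dp_eval:
  assumes "open I" "smooth_on_open I q" "x \<in> I"
  shows "kdv_B q (dp_eval P q) x = dp_eval (dp_B P) q x"
  using funpow_ddx_dp_eval[OF assms, of 3 P] funpow_ddx_dp_eval[OF assms, of 1 P]
  by (simp add: kdv_B_def dp_B_def dp_eval_add dp_eval_mult)

lemma funpow_ddx_sum:
  assumes "open I" "\<And>i. i \<in> S \<Longrightarrow> smooth_on_open I (f i)" "x \<in> I"
  shows "(ddx ^^ k) (\<lambda>x. \<Sum>i\<in>S. f i x * c i) x = (\<Sum>i\<in>S. (ddx ^^ k) (f i) x * c i)"
proof -
  have "((\<lambda>x. \<Sum>i\<in>S. (ddx ^^ k) (f i) x * c i) has_vector_derivative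
      (\<Sum>i\<in>S. (ddx ^^ Suc k) (f i) x * c i)) (at x)" if "x \<in> I" for k x
    using assms(2) that
    by (intro has_vector_derivative_sum has_vector_derivative_mult_left)
       (auto simp: smooth_on_open_def vector_derivative_works)
  from funpow_ddx_eq[of I "\<lambda>k x. \<Sum>i\<in>S. (ddx ^^ k) (f i) x * c i", OF assms(1) this assms(3)]
  show ?thesis by simp
qed

lemma kdv_B_sum:
  assumes "open I" "\<And>i. i \<in> S \<Longrightarrow> smooth_on_open I (f i)" "x \<in> I"
  shows "kdv_B q (\<lambda>x. \<Sum>i\<in>S. f i x * c i) x = (\<Sum>i\<in>S. kdv_B q (f i) x * c i)"
  using funpow_ddx_sum[OF assms, where k = 3 and c = c] funpow_ddx_sum[OF assms, where k = 1 and c = c]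
  by (simp add: kdv_B_def sum.distrib sum_distrib_left algebra_simps)

lemma smooth_on_open_const: "smooth_on_open I (\<lambda>x. c)"
proof -
  have "(ddx ^^ k) (\<lambda>x. c) = (\<lambda>x. if k = 0 then c else 0)" for k
    by (induction k) auto
  then show ?thesis by (simp add: smooth_on_open_def)
qed

lemma constant_on_iff_derivative_0:
  assumes "open I" "is_interval I"
    and "\<And>x. x \<in> I \<Longrightarrow> (f has_vector_derivative f' x) (at x)"
  shows "f constant_on I \<longleftrightarrow> (\<forall>x\<in>I. f' x = 0)"
proof
  assume "f constant_on I"
  then obtain c where c: "\<And>x. x \<in> I \<Longrightarrow> f x = c" by (auto simp: constant_on_def)
  show "\<forall>x\<in>I. f' x = 0"
  proof
    fix x assume x: "x \<in> I"
    have "(f has_vector_derivative 0) (at x)"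
      by (rule has_vector_derivative_transform_within_open[OF has_vector_derivative_const assms(1) x])
         (simp add: c)
    then show "f' x = 0" using assms(3)[OF x] vector_derivative_unique_at by blast
  qed
next
  assume "\<forall>x\<in>I. f' x = 0"
  \<comment> \<open>This direction needs the interval: a vanishing derivative forces a constant only
    on a connected set.\<close>
  then have "\<And>x. x \<in> I \<Longrightarrow> (f has_vector_derivative 0) (at x within I)"
    using assms(3) has_vector_derivative_at_within by force
  then obtain c where "\<And>x. x \<in> I \<Longrightarrow> f x = c"
    using has_vector_derivative_zero_constant[of I f] assms(2) is_interval_convex by blast
  then show "f constant_on I" by (auto simp: constant_on_def)
qed

text \<open>Regroups the triangle by the difference \<open>k - j = n - i\<close>, which is the power
  of \<open>4 * l\<close> in \<open>kdv_phi\<close>. The map sending \<open>(k, j)\<close> to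
  \<open>(n - k + j, j)\<close> is an involution.\<close>

lemma sum_triangle_reflect:
  "(\<Sum>k\<le>n. \<Sum>j\<le>k. g k j) = (\<Sum>i\<le>n. \<Sum>j\<le>i. g (n - i + j) j)"
  for g :: "nat \<Rightarrow> nat \<Rightarrow> 'a::comm_monoid_add"
  unfolding sum.Sigma[OF finite_atMost ballI[OF finite_atMost]]
  by (rule sum.reindex_bij_witness[of _ "\<lambda>(i, j). (n - i + j, j)" "\<lambda>(k, j). (n - k + j, j)"]) auto

section \<open>Solitons\<close>

text \<open>Coefficient comparison in \<open>z = 4 * l\<close>: a polynomial that vanishes at every
  complex \<open>z\<close> has zero coefficients.\<close>

lemma soliton_coeff_recursion:
  assumes "open I" "smooth_on_open I q"
    and A0: "\<And>x. x \<in> I \<Longrightarrow> A 0 x = c"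
    and A: "\<And>i. i \<in> {1..n} \<Longrightarrow> smooth_on_open I (A i)"
    and \<psi>: "\<And>l x. x \<in> I \<Longrightarrow> \<psi> l x = (\<Sum>i\<le>n. A i x * (4 * l) ^ (n - i))"
    and B: "\<And>l x. x \<in> I \<Longrightarrow> kdv_B q (\<psi> l) x = 4 * l * ddx (\<psi> l) x"
    and "i < n" "x \<in> I"
  shows "(A (Suc i) has_vector_derivative kdv_B q (A i) x) (at x)"
proof -
  have smooth: "smooth_on_open I (A i)" if "i \<le> n" for i
  proof (cases i)
    case 0
    have "smooth_on_open I (A 0)"
      by (rule smooth_on_open_cong[OF assms(1) _ smooth_on_open_const[of I c]]) (simp add: A0)
    then show ?thesis using 0 by simp
  qed (use that A in auto)
  \<comment> \<open>This removes the power \<open>z ^ (n + 1)\<close> from the right-hand side of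
    the soliton equation.\<close>
  have dA0: "ddx (A 0) x = 0"
    using funpow_ddx_cong[OF assms(1) A0 \<open>x \<in> I\<close>, where k = 1] by simp
  \<comment> \<open>At \<open>i = n\<close> there is no next coefficient, hence the default
    0.\<close>
  have z: "(\<Sum>i\<le>n. (kdv_B q (A i) x - (if i < n then ddx (A (Suc i)) x else 0)) * z ^ (n - i)) = 0" for z
  proof -
    let ?l = "z / 4"
    let ?\<psi> = "\<lambda>x. \<Sum>i\<le>n. A i x * z ^ (n - i)"
    have eq: "\<psi> ?l y = ?\<psi> y" if "y \<in> I" for y using \<psi>[OF that, of ?l] by simp
    have "(\<Sum>i\<le>n. kdv_B q (A i) x * z ^ (n - i)) = kdv_B q ?\<psi> x"
      using smooth \<open>x \<in> I\<close> by (intro kdv_B_sum[OF assms(1), symmetric]) auto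
    also have "\<dots> = kdv_B q (\<psi> ?l) x"
      using kdv_B_cong[OF assms(1) eq \<open>x \<in> I\<close>, where q = q] by simp
    also have "\<dots> = z * ddx (\<psi> ?l) x"
      using B[OF \<open>x \<in> I\<close>, of ?l] by simp
    also have "ddx (\<psi> ?l) x = ddx ?\<psi> x"
      using funpow_ddx_cong[OF assms(1) eq \<open>x \<in> I\<close>, where k = 1] by simp
    also have "\<dots> = (\<Sum>i\<le>n. ddx (A i) x * z ^ (n - i))"
      using funpow_ddx_sum[of I "{..n}" A x 1 "\<lambda>i. z ^ (n - i)"] assms(1) smooth \<open>x \<in> I\<close> by simp
    also have "\<dots> = (\<Sum>i<n. ddx (A (Suc i)) x * z ^ (n - Suc i))"
      by (simp add: sum.atMost_shift dA0)
    also have "z * \<dots> = (\<Sum>i<n. ddx (A (Suc i)) x * z ^ (n - i))"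
      by (auto simp: sum_distrib_left Suc_diff_Suc mult_ac simp flip: power_Suc intro!: sum.cong)
    also have "\<dots> = (\<Sum>i\<le>n. (if i < n then ddx (A (Suc i)) x else 0) * z ^ (n - i))"
      by (simp flip: lessThan_Suc_atMost)
    finally show ?thesis by (simp add: left_diff_distrib sum_subtractf)
  qed
  \<comment> \<open>The reversal below puts the powers in increasing order, as
    \<open>polyfun_eq_0\<close> expects.\<close>
  define h where "h j = kdv_B q (A j) x - (if j < n then ddx (A (Suc j)) x else 0)" for j
  have "(\<Sum>j\<le>n. h (n - j) * z ^ j) = 0" for z
  proof -
    have "(\<Sum>j\<le>n. h (n - j) * z ^ j) = (\<Sum>i\<le>n. h i * z ^ (n - i))"
      by (rule sum.reindex_bij_witness[of _ "\<lambda>i. n - i" "\<lambda>i. n - i"]) auto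
    then show ?thesis using z[of z] by (simp add: h_def)
  qed
  then have "\<forall>j\<le>n. h (n - j) = 0"
    using polyfun_eq_0[of "\<lambda>j. h (n - j)" n] by blast
  then have "h (n - (n - i)) = 0" using diff_le_self by blast
  then have "ddx (A (Suc i)) x = kdv_B q (A i) x" using \<open>i < n\<close> by (simp add: h_def)
  moreover have "A (Suc i) differentiable (at x)"
    using smooth[of "Suc i"] \<open>i < n\<close> \<open>x \<in> I\<close>
    by (auto simp: smooth_on_open_def dest!: spec[of _ 0])
  ultimately show ?thesis by (simp add: vector_derivative_works)
qed

text \<open>\<open>dp_B\<close> shifts the index of each \<open>dp_F\<close> under a derivative, so
  integrating an expansion shifts it and adds one constant, absorbed by the new coefficient of
  \<open>kdv_F q 0\<close>. Coefficients depend only on \<open>i - j\<close>, so one sequence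
  \<beta> serves all \<open>i\<close>.\<close>

lemma soliton_coeff_expansion:
  assumes I: "open I" "is_interval I" and q: "smooth_on_open I q"
    and A0: "\<And>x. x \<in> I \<Longrightarrow> A 0 x = c"
    and rec: "\<And>i x. i < n \<Longrightarrow> x \<in> I \<Longrightarrow>
      (A (Suc i) has_vector_derivative kdv_B q (A i) x) (at x)"
  shows "\<exists>\<beta>. \<forall>i\<le>n. \<forall>x\<in>I. A i x = (\<Sum>j\<le>i. \<beta> (i - j) * kdv_F q j x)"
  using rec
proof (induction n)
  case 0
  show ?case
    \<comment> \<open>The factor 2 compensates for \<open>kdv_F q 0 = 1/2\<close>.\<close>
    by (intro exI[of _ "\<lambda>_. 2 * c"]) (simp add: A0 kdv_F_def)
next
  case (Suc n)
  then obtain \<beta> where \<beta>: "\<And>i x. i \<le> n \<Longrightarrow> x \<in> I \<Longrightarrow> A i x = (\<Sum>j\<le>i. \<beta> (i - j) * kdv_F q j x)"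
    by (metis less_SucI)
  define Q where "Q = (\<Sum>j\<le>n. dp_const (\<beta> (n - j)) * dp_F (Suc j))"
  define P where "P = (\<Sum>j\<le>n. dp_const (\<beta> (n - j)) * dp_F j)"
  have PQ: "dp_B P = dp_deriv Q"
    unfolding P_def Q_def dp_B_sum dp_deriv_sum dp_B_scale dp_deriv_scale dp_deriv_dp_F_Suc ..
  have "kdv_B q (A n) x = dp_eval (dp_deriv Q) q x" if x: "x \<in> I" for x
  proof -
    have "A n y = dp_eval P q y" if "y \<in> I" for y
      using \<beta>[of n y] that by (simp add: P_def dp_eval_sum dp_eval_mult kdv_F_def)
    then have "kdv_B q (A n) x = kdv_B q (dp_eval P q) x"
      by (rule kdv_B_cong[OF I(1) _ x])
    then show ?thesis by (simp add: kdv_B_dp_eval[OF I(1) q x] PQ)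
  qed
  then have "((\<lambda>x. A (Suc n) x - dp_eval Q q x) has_vector_derivative 0) (at x)" if "x \<in> I" for x
    using has_vector_derivative_diff[OF Suc.prems[of n x] has_vector_derivative_dp_eval[OF q that, of Q]] that
    by simp
  then have "(\<lambda>x. A (Suc n) x - dp_eval Q q x) constant_on I"
    using constant_on_iff_derivative_0[OF I, of _ "\<lambda>_. 0"] by blast
  then obtain b where b: "\<And>x. x \<in> I \<Longrightarrow> A (Suc n) x - dp_eval Q q x = b"
    by (auto simp: constant_on_def)
  show ?case
  proof (intro exI allI impI ballI)
    fix i x assume i: "i \<le> Suc n" and x: "x \<in> I"
    \<comment> \<open>Index \<open>Suc n\<close> is reached only for \<open>i = Suc n\<close> and
      \<open>j = 0\<close>, so earlier expansions are untouched; the 2 again compensates for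
      \<open>1/2\<close>.\<close>
    let ?\<beta> = "\<beta>(Suc n := 2 * b)"
    show "A i x = (\<Sum>j\<le>i. ?\<beta> (i - j) * kdv_F q j x)"
    proof (cases "i = Suc n")
      case False
      then show ?thesis using i \<beta>[of i x] x by (auto intro!: sum.cong)
    next
      case True
      have "(\<Sum>j\<le>Suc n. ?\<beta> (Suc n - j) * kdv_F q j x) =
          b + (\<Sum>j\<le>n. \<beta> (n - j) * kdv_F q (Suc j) x)"
        unfolding sum.atMost_Suc_shift
        by (auto simp: kdv_F_def simp del: dp_F.simps(2) intro!: sum.cong)
      also have "\<dots> = b + dp_eval Q q x"
        by (simp add: Q_def dp_eval_sum dp_eval_mult kdv_F_def del: dp_F.simps)
      also have "\<dots> = A (Suc n) x" using b[OF x] by (simp add: algebra_simps)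
      finally show ?thesis using True by simp
    qed
  qed
qed

theorem theorem7p4:
  fixes I :: "real set" and q :: "real \<Rightarrow> complex" and n :: nat
  assumes "open I" and "is_interval I" and "I \<noteq> {}"
    and "smooth_on_open I q"
  shows "(\<forall>\<psi>. is_soliton I q n \<psi> \<longrightarrow>
            (\<exists>\<alpha> :: nat \<Rightarrow> complex. \<forall>l. \<forall>x\<in>I. \<psi> l x = (\<Sum>k\<le>n. \<alpha> k * kdv_phi q k l x))) \<and>
         (\<forall>\<alpha> :: nat \<Rightarrow> complex. \<alpha> n \<noteq> 0 \<longrightarrow>
            (is_soliton I q n (\<lambda>l x. \<Sum>k\<le>n. \<alpha> k * kdv_phi q k l x) \<longleftrightarrow>
             (\<lambda>x. \<Sum>k\<le>n. \<alpha> k * kdv_F q (Suc k) x) constant_on I))"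
proof (intro conjI allI impI)
  fix \<psi> assume sol: "is_soliton I q n \<psi>"
  obtain A c where A0: "\<And>x. x \<in> I \<Longrightarrow> A 0 x = c"
    and A: "\<And>i. i \<in> {1..n} \<Longrightarrow> smooth_on_open I (A i)"
    and \<psi>: "\<And>l x. x \<in> I \<Longrightarrow> \<psi> l x = (\<Sum>i\<le>n. A i x * (4 * l) ^ (n - i))"
    and B: "\<And>l x. x \<in> I \<Longrightarrow> kdv_B q (\<psi> l) x = 4 * l * ddx (\<psi> l) x"
    using sol unfolding is_soliton_def by blast
  obtain \<beta> where \<beta>: "\<And>i x. i \<le> n \<Longrightarrow> x \<in> I \<Longrightarrow> A i x = (\<Sum>j\<le>i. \<beta> (i - j) * kdv_F q j x)"
    using soliton_coeff_expansion[where A = A and n = n, OF assms(1,2,4) A0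
        soliton_coeff_recursion[where A = A and n = n, OF assms(1,4) A0 A \<psi> B]]
    by blast
  \<comment> \<open>With \<open>k = n - i + j\<close> the coefficient index \<open>i - j\<close>
    becomes \<open>n - k\<close>.\<close>
  have "\<psi> l x = (\<Sum>k\<le>n. \<beta> (n - k) * kdv_phi q k l x)" if x: "x \<in> I" for l x
  proof -
    have "(\<Sum>k\<le>n. \<beta> (n - k) * kdv_phi q k l x) =
        (\<Sum>k\<le>n. \<Sum>j\<le>k. \<beta> (n - k) * ((4 * l) ^ (k - j) * kdv_F q j x))"
      by (simp add: kdv_phi_def sum_distrib_left)
    also have "\<dots> = (\<Sum>i\<le>n. \<Sum>j\<le>i. \<beta> (n - (n - i + j)) * ((4 * l) ^ (n - i + j - j) * kdv_F q j x))"
      by (rule sum_triangle_reflect)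
    also have "\<dots> = (\<Sum>i\<le>n. A i x * (4 * l) ^ (n - i))"
      by (auto simp: \<beta> x sum_distrib_left sum_distrib_right mult_ac intro!: sum.cong)
    finally show ?thesis using \<psi>[OF x] by simp
  qed
  then show "\<exists>\<alpha>. \<forall>l. \<forall>x\<in>I. \<psi> l x = (\<Sum>k\<le>n. \<alpha> k * kdv_phi q k l x)"
    by (intro exI[of _ "\<lambda>k. \<beta> (n - k)"]) blast
next
  fix \<alpha> :: "nat \<Rightarrow> complex" assume \<alpha>: "\<alpha> n \<noteq> 0"
  let ?\<psi> = "\<lambda>l x. \<Sum>k\<le>n. \<alpha> k * kdv_phi q k l x"
  \<comment> \<open>The terms of the combination with \<open>k - j = n - i\<close>, collected as the
    coefficient of \<open>(4 * l) ^ (n - i)\<close>.\<close>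
  define A where "A i = dp_eval (\<Sum>j\<le>i. dp_const (\<alpha> (n - i + j)) * dp_F j) q" for i
  define R where "R = (\<Sum>k\<le>n. dp_const (\<alpha> k) * dp_F (Suc k))"
  define \<Phi> where "\<Phi> l = (\<Sum>k\<le>n. dp_const (\<alpha> k) * dp_phi (4 * l) k)" for l
  have A0: "A 0 x = \<alpha> n / 2" for x
    by (simp add: A_def dp_eval_mult)
  have \<psi>A: "?\<psi> l x = (\<Sum>i\<le>n. A i x * (4 * l) ^ (n - i))" for l x
  proof -
    have "?\<psi> l x = (\<Sum>k\<le>n. \<Sum>j\<le>k. \<alpha> k * ((4 * l) ^ (k - j) * kdv_F q j x))"
      by (simp add: kdv_phi_def sum_distrib_left)
    also have "\<dots> = (\<Sum>i\<le>n. \<Sum>j\<le>i. \<alpha> (n - i + j) * ((4 * l) ^ (n - i + j - j) * kdv_F q j x))"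
      by (rule sum_triangle_reflect)
    also have "\<dots> = (\<Sum>i\<le>n. A i x * (4 * l) ^ (n - i))"
      by (simp add: A_def dp_eval_sum dp_eval_mult kdv_F_def sum_distrib_left sum_distrib_right mult_ac)
    finally show ?thesis .
  qed
  have \<Phi>: "?\<psi> l = dp_eval (\<Phi> l) q" for l
    by (auto simp: \<Phi>_def dp_eval_sum dp_eval_mult dp_eval_phi)
  \<comment> \<open>The defect in the soliton equation is the same for every \<open>l\<close>, so
    all values of the parameter impose the single condition that \<open>R\<close> has derivative
    zero along \<open>q\<close>.\<close>
  have \<Phi>R: "dp_B (\<Phi> l) - dp_const (4 * l) * dp_deriv (\<Phi> l) = dp_deriv R" for l
  proof -
    have "dp_B (\<Phi> l) - dp_const (4 * l) * dp_deriv (\<Phi> l) =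
        (\<Sum>k\<le>n. dp_const (\<alpha> k) *
          (dp_B (dp_phi (4 * l) k) - dp_const (4 * l) * dp_deriv (dp_phi (4 * l) k)))"
      unfolding \<Phi>_def dp_B_sum dp_deriv_sum dp_B_scale dp_deriv_scale sum_distrib_left
        right_diff_distrib sum_subtractf
      by (simp only: mult.left_commute)
    also have "\<dots> = dp_deriv R"
      unfolding dp_B_phi R_def dp_deriv_sum dp_deriv_scale ..
    finally show ?thesis .
  qed
  have B: "kdv_B q (?\<psi> l) x = 4 * l * ddx (?\<psi> l) x \<longleftrightarrow> dp_eval (dp_deriv R) q x = 0"
    if x: "x \<in> I" for l x
  proof -
    have "ddx (dp_eval (\<Phi> l) q) x = dp_eval (dp_deriv (\<Phi> l)) q x"
      by (rule vector_derivative_at[OF has_vector_derivative_dp_eval[OF assms(4) x]])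
    then show ?thesis
      unfolding \<Phi> kdv_B_dp_eval[OF assms(1,4) x] \<Phi>R[of l, symmetric]
      by (simp only: dp_eval_diff dp_eval_mult dp_eval_const right_minus_eq)
  qed
  \<comment> \<open>The coefficients \<open>A\<close> already have the required shape, with
    \<open>A 0\<close> nonzero since \<open>\<alpha> n\<close> is; only the differential equation is
    left.\<close>
  have "is_soliton I q n ?\<psi> \<longleftrightarrow> (\<forall>l. \<forall>x\<in>I. kdv_B q (?\<psi> l) x = 4 * l * ddx (?\<psi> l) x)"
  proof
    assume "\<forall>l. \<forall>x\<in>I. kdv_B q (?\<psi> l) x = 4 * l * ddx (?\<psi> l) x"
    moreover have "\<exists>c. c \<noteq> 0 \<and> (\<forall>x\<in>I. A 0 x = c)"
      using A0 \<alpha> by (intro exI[of _ "\<alpha> n / 2"]) simp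
    moreover have "\<forall>i\<in>{1..n}. smooth_on_open I (A i)"
      unfolding A_def using smooth_on_open_dp_eval[OF assms(1,4)] by blast
    ultimately show "is_soliton I q n ?\<psi>"
      unfolding is_soliton_def using \<psi>A by blast
  qed (unfold is_soliton_def, elim conjE)
  also have "\<dots> \<longleftrightarrow> (\<forall>x\<in>I. dp_eval (dp_deriv R) q x = 0)"
    by (simp only: B ball_simps cong: ball_cong) simp
  also have "\<dots> \<longleftrightarrow> dp_eval R q constant_on I"
    using constant_on_iff_derivative_0[OF assms(1,2) has_vector_derivative_dp_eval[OF assms(4)]]
    by simp
  also have "dp_eval R q = (\<lambda>x. \<Sum>k\<le>n. \<alpha> k * kdv_F q (Suc k) x)"
    by (auto simp: R_def dp_eval_sum dp_eval_mult kdv_F_def simp del: dp_F.simps)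
  finally show "is_soliton I q n ?\<psi> \<longleftrightarrow>
      (\<lambda>x. \<Sum>k\<le>n. \<alpha> k * kdv_F q (Suc k) x) constant_on I" .
qed

end
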